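(* Let $P$ be a finite poset and let $b\in P$ be a removable element of $P$, i.e. $b$ covers at most one element of $P$ and is covered by at most one element of $P$. Let $P\setminus\{b\}$ denote the induced subposet on $P\setminus\{b\}$. Then \[ f_P(\mathbf x)=\frac{g(\mathbf x)-h(\mathbf x)}{1-x_b}, \] where \[ g(\mathbf x)=\begin{cases} f_{P\setminus\{b\}}(\mathbf x)\big|_{x_c=x_bx_c}, & \text{if there is } c\in P \text{ with } b\lessdot c,\\ f_{P\setminus\{b\}}(\mathbf x), & \text{otherwise,}\end{cases} \] and \[ h(\mathbf x)=\begin{cases} x_b\, f_{P\setminus\{b\}}(\mathbf x)\big|_{x_a=x_ax_b}, & \text{if there is } a\in P \text{ with } a\lessdot b,\\ 0, & \text{otherwise.}\end{cases} \] (Here $f|_{x_c=x_bx_c}$ means the variable $x_c$ is replaced by $x_bx_c$ and all other variables are unchanged.)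
   Context: For a finite poset $P$, a $P$-partition is a map $\sigma:P\to\mathbb{Z}_{\ge 0}$ that is order-reversing: $x\le_P y$ implies $\sigma(x)\ge\sigma(y)$. Writing $\mathrm{Par}(P)$ for the set of $P$-partitions, the generating function is the formal power series $f_P(\mathbf x)=\sum_{\sigma\in\mathrm{Par}(P)}\prod_{a\in P}x_a^{\sigma(a)}$ in variables $\mathbf x=(x_a)_{a\in P}$ (for the empty poset, $f=1$). We write $x\lessdot y$ ($y$ covers $x$) if $x<y$ and no $z$ satisfies $x<z<y$. *)

theory Defs
  imports Complex_Main "HOL-Library.Poly_Mapping" "HOL-Library.FuncSet"
begin

section \<open>Multivariate formal power series\<close>

text \<open>
  Exponent vectors are finitely supported maps \<^typ>\<open>'a \<Rightarrow>\<^sub>0 nat\<close>, so \<open>('a, 'r) mps\<close> is the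
  ring of formal power series over \<open>'r\<close> in one variable for each element of the (possibly
  infinite) type \<open>'a\<close>. The series attached to a finite poset \<open>P\<close> only involve the
  variables indexed by \<open>P\<close>.
\<close>

typedef ('a, 'r) mps = "UNIV :: (('a \<Rightarrow>\<^sub>0 nat) \<Rightarrow> 'r) set"
  morphisms mps_coeff Abs_mps
  by simp

lemma mps_coeff_Abs [simp]: "mps_coeff (Abs_mps f) m = f m"
  by (simp add: Abs_mps_inverse)

lemma mps_eqI: "(\<And>m. mps_coeff f m = mps_coeff g m) \<Longrightarrow> f = g"
  by (metis ext mps_coeff_inject)

lemma finite_add_decomp: "finite {(k, l). k + l = (m :: 'a \<Rightarrow>\<^sub>0 nat)}"
proof -
  let ?B = "\<Union>i\<in>Poly_Mapping.keys m. {..Poly_Mapping.lookup m i}"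
  let ?F = "{f :: 'a \<Rightarrow> nat. \<forall>x. (x \<in> Poly_Mapping.keys m \<longrightarrow> f x \<in> ?B) \<and> (x \<notin> Poly_Mapping.keys m \<longrightarrow> f x = 0)}"
  have fin: "finite ?F"
    by (rule finite_set_of_finite_funs) auto
  have sub: "(\<lambda>(k, l). Poly_Mapping.lookup k) ` {(k, l). k + l = m} \<subseteq> ?F"
  proof clarify
    fix k l :: "'a \<Rightarrow>\<^sub>0 nat" and x
    assume "m = k + l"
    then show "(x \<in> Poly_Mapping.keys (k + l) \<longrightarrow> Poly_Mapping.lookup k x \<in>
        (\<Union>i\<in>Poly_Mapping.keys (k + l). {..Poly_Mapping.lookup (k + l) i})) \<and>
      (x \<notin> Poly_Mapping.keys (k + l) \<longrightarrow> Poly_Mapping.lookup k x = 0)"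
      by (auto simp: lookup_add in_keys_iff intro!: bexI [of _ x])
  qed
  have inj: "inj_on (\<lambda>(k, l). Poly_Mapping.lookup k) {(k, l). k + l = m}"
    by (rule inj_onI) (auto simp: lookup_inject)
  show ?thesis
    using finite_imageD [OF finite_subset [OF sub fin] inj] .
qed

instantiation mps :: (type, zero) zero
begin
definition "0 = Abs_mps (\<lambda>m. 0)"
instance ..
end

instantiation mps :: (type, zero_neq_one) one
begin
definition "1 = Abs_mps (\<lambda>m. if m = 0 then 1 else 0)"
instance ..
end

instantiation mps :: (type, plus) plus
begin
definition "f + g = Abs_mps (\<lambda>m. mps_coeff f m + mps_coeff g m)"
instance ..
end

instantiation mps :: (type, minus) minus
begin
definition "f - g = Abs_mps (\<lambda>m. mps_coeff f m - mps_coeff g m)"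
instance ..
end

instantiation mps :: (type, uminus) uminus
begin
definition "- f = Abs_mps (\<lambda>m. - mps_coeff f m)"
instance ..
end

instantiation mps :: (type, semiring_0) times
begin
definition "f * g = Abs_mps (\<lambda>m. \<Sum>(k, l) | k + l = m. mps_coeff f k * mps_coeff g l)"
instance ..
end

lemma mps_coeff_0 [simp]: "mps_coeff 0 m = 0"
  and mps_coeff_1: "mps_coeff 1 m = (if m = 0 then 1 else 0)"
  and mps_coeff_add [simp]: "mps_coeff (f + g) m = mps_coeff f m + mps_coeff g m"
  and mps_coeff_diff [simp]: "mps_coeff (f' - g') m = mps_coeff f' m - mps_coeff g' m"
  and mps_coeff_uminus [simp]: "mps_coeff (- h) m = - mps_coeff h m"
  and mps_coeff_mult:
    "mps_coeff (u * v) m = (\<Sum>(k, l) | k + l = m. mps_coeff u k * mps_coeff v l)"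
  by (simp_all add: zero_mps_def one_mps_def plus_mps_def minus_mps_def uminus_mps_def
      times_mps_def)

instance mps :: (type, comm_ring_1) comm_ring_1
proof
  fix f g h :: "('a, 'b) mps"
  show "f * g * h = f * (g * h)"
  proof (rule mps_eqI)
    fix m
    let ?D = "\<lambda>m :: 'a \<Rightarrow>\<^sub>0 nat. {p. fst p + snd p = m}"
    have fin: "finite (?D m)" for m
      using finite_add_decomp [of m] by (simp add: case_prod_unfold)
    have "mps_coeff (f * g * h) m = (\<Sum>p\<in>?D m. \<Sum>q\<in>?D (fst p).
        mps_coeff f (fst q) * mps_coeff g (snd q) * mps_coeff h (snd p))"
      by (simp add: mps_coeff_mult sum_distrib_right case_prod_unfold)
    also have "\<dots> = (\<Sum>(p, q) \<in> Sigma (?D m) (\<lambda>p. ?D (fst p)).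
        mps_coeff f (fst q) * mps_coeff g (snd q) * mps_coeff h (snd p))"
      by (rule sum.Sigma) (auto simp: fin)
    also have "\<dots> = (\<Sum>(p, q) \<in> Sigma (?D m) (\<lambda>p. ?D (snd p)).
        mps_coeff f (fst p) * (mps_coeff g (fst q) * mps_coeff h (snd q)))"
      by (rule sum.reindex_bij_witness
            [where i = "\<lambda>((k, l), (i, j)). ((k + i, j), (k, i))"
               and j = "\<lambda>((k, l), (i, j)). ((i, j + l), (j, l))"])
         (auto simp: add.assoc mult.assoc)
    also have "\<dots> = (\<Sum>p\<in>?D m. \<Sum>q\<in>?D (snd p).
        mps_coeff f (fst p) * (mps_coeff g (fst q) * mps_coeff h (snd q)))"
      by (rule sum.Sigma [symmetric]) (auto simp: fin)
    also have "\<dots> = mps_coeff (f * (g * h)) m"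
      by (simp add: mps_coeff_mult sum_distrib_left case_prod_unfold)
    finally show "mps_coeff (f * g * h) m = mps_coeff (f * (g * h)) m" .
  qed
  show "f * g = g * f"
  proof (rule mps_eqI)
    fix m
    show "mps_coeff (f * g) m = mps_coeff (g * f) m"
      unfolding mps_coeff_mult
      by (rule sum.reindex_bij_witness [where i = prod.swap and j = prod.swap])
         (auto simp: add.commute mult.commute)
  qed
  show "1 * f = f"
  proof (rule mps_eqI)
    fix m
    have "mps_coeff (1 * f) m =
        (\<Sum>p | fst p + snd p = m. if p = (0, m) then mps_coeff f m else 0)"
      unfolding mps_coeff_mult case_prod_unfold
      by (rule sum.cong) (auto simp: mps_coeff_1)
    also have "\<dots> = mps_coeff f m"
      using finite_add_decomp [of m] by (subst sum.delta) (auto simp: case_prod_unfold)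
    finally show "mps_coeff (1 * f) m = mps_coeff f m" .
  qed
  show "(f + g) * h = f * h + g * h"
    by (rule mps_eqI)
       (simp add: mps_coeff_mult case_prod_unfold distrib_right sum.distrib)
  show "(0 :: ('a, 'b) mps) \<noteq> 1"
  proof
    assume "(0 :: ('a, 'b) mps) = 1"
    from arg_cong [OF this, of "\<lambda>f. mps_coeff f 0"] show False
      by (simp add: mps_coeff_1)
  qed
qed (auto intro!: mps_eqI)

text \<open>
  Division by a unit is multiplication by its inverse in the ring; as usual in HOL, the inverse
  of a non-unit is an arbitrary value, here \<open>0\<close>.
\<close>

instantiation mps :: (type, comm_ring_1) inverse
begin
definition inverse_mps_def: "inverse (f :: ('a, 'b) mps) = (if f dvd 1 then THE g. f * g = 1 else 0)"
definition divide_mps_def: "(f :: ('a, 'b) mps) div g = f * inverse g"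
instance ..
end

lemma mps_inverse_unit:
  fixes f :: "('a, 'r::comm_ring_1) mps"
  assumes "f dvd 1"
  shows "f * inverse f = 1"
proof -
  obtain g where g: "f * g = 1"
    using assms by (metis dvdE)
  have "h = g" if "f * h = 1" for h
  proof -
    have "h = (f * g) * h"
      by (simp add: g)
    also have "\<dots> = (f * h) * g"
      by (simp add: ac_simps)
    finally show ?thesis
      by (simp add: that)
  qed
  then show ?thesis
    using assms g by (simp add: inverse_mps_def) (rule theI [of "\<lambda>g. f * g = 1"])
qed

definition mps_const :: "'r \<Rightarrow> ('a, 'r::comm_ring_1) mps"
  where "mps_const c = Abs_mps (\<lambda>m. if m = 0 then c else 0)"

definition mps_monom :: "('a \<Rightarrow>\<^sub>0 nat) \<Rightarrow> ('a, 'r::comm_ring_1) mps"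
  where "mps_monom e = Abs_mps (\<lambda>m. if m = e then 1 else 0)"

definition mps_X :: "'a \<Rightarrow> ('a, 'r::comm_ring_1) mps"
  where "mps_X a = mps_monom (Poly_Mapping.single a 1)"

text \<open>
  The formal sum of a locally finite family of series: each coefficient of the sum is a sum in
  \<open>'r\<close> with finitely many nonzero terms. Without local finiteness, \<open>mps_infsum\<close> has the usual
  junk value \<open>0\<close> at the offending coefficients; it is only used where the family is locally finite
  (see \<open>P_partition_family_locally_finite\<close> and \<open>mps_subst_family_locally_finite\<close> below).
\<close>

definition mps_locally_finite :: "('i \<Rightarrow> ('a, 'r::comm_ring_1) mps) \<Rightarrow> 'i set \<Rightarrow> bool"
  where "mps_locally_finite F I \<longleftrightarrow> (\<forall>m. finite {i \<in> I. mps_coeff (F i) m \<noteq> 0})"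

definition mps_infsum :: "('i \<Rightarrow> ('a, 'r::comm_ring_1) mps) \<Rightarrow> 'i set \<Rightarrow> ('a, 'r) mps"
  where "mps_infsum F I =
    Abs_mps (\<lambda>m. \<Sum>i | i \<in> I \<and> mps_coeff (F i) m \<noteq> 0. mps_coeff (F i) m)"

text \<open>Substitution: every variable \<open>x\<^sub>i\<close> is simultaneously replaced by \<open>S i\<close>.\<close>

definition mps_subst :: "('a \<Rightarrow> ('a, 'r::comm_ring_1) mps) \<Rightarrow> ('a, 'r) mps \<Rightarrow> ('a, 'r) mps"
  where "mps_subst S f =
    mps_infsum (\<lambda>m. mps_const (mps_coeff f m) *
      (\<Prod>i\<in>Poly_Mapping.keys m. S i ^ Poly_Mapping.lookup m i)) UNIV"


section \<open>Posets and their \<open>P\<close>-partitions\<close>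

text \<open>
  A poset is a carrier \<open>P\<close> with a relation \<open>r\<close> such that \<^term>\<open>partial_order_on P r\<close>; then
  \<open>(x, y) \<in> r\<close> means \<open>x \<le> y\<close>, and in particular \<open>r \<subseteq> P \<times> P\<close>.
\<close>

definition covered_by :: "'a rel \<Rightarrow> 'a \<Rightarrow> 'a \<Rightarrow> bool"
  where "covered_by r x y \<longleftrightarrow>
    (x, y) \<in> r - Id \<and> \<not> (\<exists>z. (x, z) \<in> r - Id \<and> (z, y) \<in> r - Id)"

definition removable :: "'a set \<Rightarrow> 'a rel \<Rightarrow> 'a \<Rightarrow> bool"
  where "removable P r b \<longleftrightarrow> b \<in> P \<and>
    (\<exists>\<^sub>\<le>\<^sub>1 a. a \<in> P \<and> covered_by r a b) \<and> (\<exists>\<^sub>\<le>\<^sub>1 c. c \<in> P \<and> covered_by r b c)"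

text \<open>
  Maps on \<open>P\<close> are represented by extensional functions, so that distinct members of
  \<open>P_partitions P r\<close> differ on \<open>P\<close>.
\<close>

definition P_partitions :: "'a set \<Rightarrow> 'a rel \<Rightarrow> ('a \<Rightarrow> nat) set"
  where "P_partitions P r = {\<sigma> \<in> P \<rightarrow>\<^sub>E UNIV. \<forall>(x, y) \<in> r. \<sigma> x \<ge> \<sigma> y}"

definition P_partition_gf :: "'a set \<Rightarrow> 'a rel \<Rightarrow> ('a, 'r::comm_ring_1) mps"
  where "P_partition_gf P r = mps_infsum (\<lambda>\<sigma>. \<Prod>a\<in>P. mps_X a ^ \<sigma> a) (P_partitions P r)"

abbreviation delete_order :: "'a set \<Rightarrow> 'a rel \<Rightarrow> 'a \<Rightarrow> 'a rel"
  where "delete_order P r b \<equiv> Restr r (P - {b})"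

text \<open>For removable \<open>b\<close> the elements selected by \<open>THE\<close> below are unique when they exist.\<close>

definition removal_g :: "'a set \<Rightarrow> 'a rel \<Rightarrow> 'a \<Rightarrow> ('a, 'r::comm_ring_1) mps"
  where "removal_g P r b =
    (let f = P_partition_gf (P - {b}) (delete_order P r b) in
     if \<exists>c\<in>P. covered_by r b c
     then let c = (THE c. c \<in> P \<and> covered_by r b c)
          in mps_subst (mps_X(c := mps_X b * mps_X c)) f
     else f)"

definition removal_h :: "'a set \<Rightarrow> 'a rel \<Rightarrow> 'a \<Rightarrow> ('a, 'r::comm_ring_1) mps"
  where "removal_h P r b =
    (let f = P_partition_gf (P - {b}) (delete_order P r b) in
     if \<exists>a\<in>P. covered_by r a b
     then let a = (THE a. a \<in> P \<and> covered_by r a b)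
          in mps_X b * mps_subst (mps_X(a := mps_X a * mps_X b)) f
     else 0)"


section \<open>Well-definedness\<close>

lemma mps_coeff_monom_mult:
  "mps_coeff (mps_monom k * f) m =
    (if \<exists>l. k + l = m then mps_coeff f (m - k) else (0 :: 'r::comm_ring_1))"
proof -
  have "mps_coeff (mps_monom k * f) m =
      (\<Sum>p | fst p + snd p = m. if p = (k, m - k) then mps_coeff f (m - k) else 0)"
    unfolding mps_coeff_mult case_prod_unfold mps_monom_def by (rule sum.cong) auto
  also have "\<dots> = (if k + (m - k) = m then mps_coeff f (m - k) else 0)"
    using finite_add_decomp [of m] by (subst sum.delta) (auto simp: case_prod_unfold)
  also have "(k + (m - k) = m) = (\<exists>l. k + l = m)"
    by (metis add_diff_cancel_left')
  finally show ?thesis .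
qed

lemma mps_monom_0: "mps_monom 0 = 1"
  by (simp add: mps_monom_def one_mps_def)

lemma mps_monom_add: "mps_monom (k + l) = mps_monom k * mps_monom l"
  by (rule mps_eqI) (auto simp: mps_coeff_monom_mult, auto simp: mps_monom_def)

lemma mps_X_power: "mps_X a ^ n = mps_monom (Poly_Mapping.single a n)"
proof (induction n)
  case 0
  show ?case by (simp add: mps_monom_0)
next
  case (Suc n)
  have "Poly_Mapping.single a (Suc n) = Poly_Mapping.single a 1 + Poly_Mapping.single a n"
    by (simp add: single_add [symmetric])
  then show ?case
    by (simp only: power_Suc Suc.IH mps_monom_add) (simp add: mps_X_def)
qed

lemma mps_X_power_prod:
  assumes "finite A"
  shows "(\<Prod>a\<in>A. mps_X a ^ e a) = mps_monom (\<Sum>a\<in>A. Poly_Mapping.single a (e a))"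
  using assms by induction (simp_all add: mps_monom_0 mps_monom_add mps_X_power)

lemma lookup_exponent_sum:
  assumes "finite A"
  shows "Poly_Mapping.lookup (\<Sum>a\<in>A. Poly_Mapping.single a (e a)) x = (if x \<in> A then e x else (0::nat))"
  using assms by (simp add: lookup_sum lookup_single when_def)

lemma P_partition_family_locally_finite:
  assumes "finite P"
  shows "mps_locally_finite
    (\<lambda>\<sigma>. (\<Prod>a\<in>P. mps_X a ^ \<sigma> a) :: ('a, 'r::comm_ring_1) mps) (P_partitions P r)"
  unfolding mps_locally_finite_def
proof
  fix m
  have "{\<sigma> \<in> P_partitions P r. mps_coeff ((\<Prod>a\<in>P. mps_X a ^ \<sigma> a) :: ('a, 'r) mps) m \<noteq> 0}
      \<subseteq> {restrict (Poly_Mapping.lookup m) P}"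
    using assms
    by (auto simp: mps_X_power_prod mps_monom_def P_partitions_def lookup_exponent_sum PiE_def extensional_def
        restrict_def split: if_splits)
  then show "finite {\<sigma> \<in> P_partitions P r.
      mps_coeff ((\<Prod>a\<in>P. mps_X a ^ \<sigma> a) :: ('a, 'r) mps) m \<noteq> 0}"
    by (rule finite_subset) simp
qed

lemma mps_coeff_const_mult:
  "mps_coeff (mps_const c * f) m = (c * mps_coeff f m :: 'r::comm_ring_1)"
proof -
  have "mps_coeff (mps_const c * f) m =
      (\<Sum>p | fst p + snd p = m. if p = (0, m) then c * mps_coeff f m else 0)"
    unfolding mps_coeff_mult case_prod_unfold mps_const_def by (rule sum.cong) auto
  also have "\<dots> = c * mps_coeff f m"
    using finite_add_decomp [of m] by (subst sum.delta) (auto simp: case_prod_unfold)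
  finally show ?thesis .
qed

lemma mps_subst_family_locally_finite:
  fixes f :: "('a, 'r::comm_ring_1) mps"
  shows "mps_locally_finite (\<lambda>m. mps_const (mps_coeff f m) *
    (\<Prod>i\<in>Poly_Mapping.keys m. (mps_X(c := mps_X b * mps_X c)) i ^ Poly_Mapping.lookup m i)) UNIV"
    (is "mps_locally_finite ?F UNIV")
  unfolding mps_locally_finite_def
proof
  fix n :: "'a \<Rightarrow>\<^sub>0 nat"
  let ?S = "mps_X(c := mps_X b * mps_X c) :: 'a \<Rightarrow> ('a, 'r) mps"
  have S: "\<exists>l. ?S i ^ k = mps_monom (Poly_Mapping.single i k + l)" for i k
  proof (cases "i = c")
    case True
    then show ?thesis
      by (auto simp: power_mult_distrib mps_X_power mps_monom_add [symmetric] add.commute)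
  next
    case False
    then have "?S i ^ k = mps_monom (Poly_Mapping.single i k + 0)"
      by (simp add: mps_X_power)
    then show ?thesis ..
  qed
  have prod: "\<exists>l. (\<Prod>i\<in>A. ?S i ^ Poly_Mapping.lookup m i) =
      mps_monom ((\<Sum>i\<in>A. Poly_Mapping.single i (Poly_Mapping.lookup m i)) + l)"
    if "finite A" for A m
    using that
  proof induction
    case empty
    show ?case by (auto intro!: exI [of _ 0] simp: mps_monom_0)
  next
    case (insert i A)
    obtain l where l: "(\<Prod>i\<in>A. ?S i ^ Poly_Mapping.lookup m i) =
      mps_monom ((\<Sum>i\<in>A. Poly_Mapping.single i (Poly_Mapping.lookup m i)) + l)"
      using insert.IH by blast
    obtain l' where l': "?S i ^ Poly_Mapping.lookup m i =
      mps_monom (Poly_Mapping.single i (Poly_Mapping.lookup m i) + l')"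
      using S by blast
    show ?case
      unfolding prod.insert [OF insert.hyps] sum.insert [OF insert.hyps] l l'
        mps_monom_add [symmetric]
      by (rule exI [of _ "l' + l"]) (simp add: ac_simps)
  qed
  have sum: "(\<Sum>i\<in>Poly_Mapping.keys m. Poly_Mapping.single i (Poly_Mapping.lookup m i)) = m"
    for m :: "'a \<Rightarrow>\<^sub>0 nat"
    by (rule poly_mapping_eqI) (simp add: lookup_exponent_sum in_keys_iff)
  have prod': "\<exists>l. (\<Prod>i\<in>Poly_Mapping.keys m. ?S i ^ Poly_Mapping.lookup m i) = mps_monom (m + l)"
    for m
    using prod [of "Poly_Mapping.keys m" m] unfolding sum by simp
  have "{m \<in> UNIV. mps_coeff (?F m) n \<noteq> 0} \<subseteq> fst ` {(k, l). k + l = n}"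
  proof
    fix m assume "m \<in> {m \<in> UNIV. mps_coeff (?F m) n \<noteq> 0}"
    moreover obtain l where
      "(\<Prod>i\<in>Poly_Mapping.keys m. ?S i ^ Poly_Mapping.lookup m i) = mps_monom (m + l)"
      using prod' by blast
    ultimately have "m + l = n"
      by (auto simp: mps_coeff_const_mult mps_monom_def split: if_splits)
    then show "m \<in> fst ` {(k, l). k + l = n}"
      by force
  qed
  then show "finite {m \<in> UNIV. mps_coeff (?F m) n \<noteq> 0}"
    by (rule finite_subset) (intro finite_imageI finite_add_decomp)
qed

lemma P_partition_gf_empty: "P_partition_gf {} {} = 1"
  by (rule mps_eqI) (simp add: P_partition_gf_def mps_infsum_def P_partitions_def mps_coeff_1)

lemma one_minus_mps_X_unit: "(1 - mps_X b :: ('a, 'r::comm_ring_1) mps) dvd 1"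
proof -
  define G :: "('a, 'r) mps" where "G = Abs_mps (\<lambda>m. if Poly_Mapping.keys m \<subseteq> {b} then 1 else 0)"
  have "(1 - mps_X b) * G = 1"
  proof (rule mps_eqI)
    fix m :: "'a \<Rightarrow>\<^sub>0 nat"
    have ex: "(\<exists>l. Poly_Mapping.single b 1 + l = m) \<longleftrightarrow> Poly_Mapping.lookup m b \<noteq> 0"
    proof
      assume "Poly_Mapping.lookup m b \<noteq> 0"
      then have "Poly_Mapping.single b 1 + (m - Poly_Mapping.single b 1) = m"
        by (intro poly_mapping_eqI) (auto simp: lookup_add lookup_minus lookup_single when_def)
      then show "\<exists>l. Poly_Mapping.single b 1 + l = m" ..
    qed (auto simp: lookup_add)
    have keys: "Poly_Mapping.keys (m - Poly_Mapping.single b 1) \<subseteq> {b} \<longleftrightarrow> Poly_Mapping.keys m \<subseteq> {b}"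
      by (auto simp: subset_iff in_keys_iff lookup_minus lookup_single when_def)
    have "Poly_Mapping.keys m \<subseteq> {b} \<and> Poly_Mapping.lookup m b = 0 \<longleftrightarrow> m = 0"
      by (auto intro!: poly_mapping_eqI simp: in_keys_iff subset_iff)
    then show "mps_coeff ((1 - mps_X b) * G) m = mps_coeff 1 m"
      using ex keys
      by (auto simp: left_diff_distrib mps_X_def mps_coeff_monom_mult G_def mps_coeff_1)
  qed
  then show ?thesis by (metis dvdI)
qed

lemma mps_eq_divide_one_minus_X_iff:
  fixes f g :: "('a, 'r::comm_ring_1) mps"
  shows "f = g / (1 - mps_X b) \<longleftrightarrow> (1 - mps_X b) * f = g"
proof
  have inv: "(1 - mps_X b) * inverse (1 - mps_X b) = (1 :: ('a, 'r) mps)"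
    by (rule mps_inverse_unit [OF one_minus_mps_X_unit])
  {
    assume "f = g / (1 - mps_X b)"
    then have "(1 - mps_X b) * f = g * ((1 - mps_X b) * inverse (1 - mps_X b))"
      unfolding divide_mps_def by (simp only: ac_simps)
    then show "(1 - mps_X b) * f = g"
      unfolding inv by simp
  next
    assume g: "(1 - mps_X b) * f = g"
    have "g / (1 - mps_X b) = f * ((1 - mps_X b) * inverse (1 - mps_X b))"
      unfolding divide_mps_def g [symmetric] by (simp only: ac_simps)
    then show "f = g / (1 - mps_X b)"
      unfolding inv by simp
  }
qed

end

theory Submission
  imports Defs
begin

text \<open>
  Multiply by \<open>1 - x\<^sub>b\<close> and compare coefficients. A \<open>P\<close>-partition is a \<open>P \<setminus> {b}\<close>-partition \<open>\<tau>\<close>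
  together with a value \<open>k\<close> at \<open>b\<close>, and since \<open>b\<close> is removable the only conditions on \<open>k\<close> are
  \<open>\<tau> c \<le> k\<close> for its upper cover \<open>c\<close> and \<open>k \<le> \<tau> a\<close> for its lower cover \<open>a\<close> (if they exist).
  So \<open>k\<close> ranges over an interval, and multiplication by \<open>1 - x\<^sub>b\<close> telescopes the sum of \<open>x\<^sub>b\<^sup>k\<close>
  to its first term, which contributes to \<open>g\<close>, minus the term following the last one, which
  contributes to \<open>h\<close>.
\<close>

section \<open>Coefficients of the generating function\<close>

definition partition_exponent :: "'a set \<Rightarrow> 'a rel \<Rightarrow> ('a \<Rightarrow>\<^sub>0 nat) \<Rightarrow> bool"
  where "partition_exponent P r m \<longleftrightarrow> Poly_Mapping.keys m \<subseteq> P \<and>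
    (\<forall>(x, y) \<in> r. Poly_Mapping.lookup m y \<le> Poly_Mapping.lookup m x)"

text \<open>In both kinds of infinite sum used here, at most one index contributes to a given
  monomial, so coefficients can be read off directly. The candidate \<open>j\<close> may lie outside
  \<open>I\<close>: exponents need not come from a P-partition.\<close>

lemma mps_coeff_infsum_single:
  assumes "\<And>i. i \<in> I \<Longrightarrow> i \<noteq> j \<Longrightarrow> mps_coeff (F i) m = 0"
  shows "mps_coeff (mps_infsum F I) m = (if j \<in> I then mps_coeff (F j) m else 0)"
proof -
  have set: "{i. i \<in> I \<and> mps_coeff (F i) m \<noteq> 0} = (if j \<in> I \<and> mps_coeff (F j) m \<noteq> 0 then {j} else {})"
    using assms by auto
  show ?thesis
    unfolding mps_infsum_def mps_coeff_Abs set by simp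
qed

text \<open>A monomial determines its P-partition, the restriction of its exponent vector to
  \<open>P\<close>, so no coefficient exceeds one term. In \<open>partition_exponent\<close> the
  condition on \<open>keys m\<close> takes over the role of extensionality.\<close>

lemma mps_coeff_P_partition_gf:
  assumes "finite P" "r \<subseteq> P \<times> P"
  shows "mps_coeff (P_partition_gf P r :: ('a, 'r::comm_ring_1) mps) m =
    (if partition_exponent P r m then 1 else 0)"
proof -
  let ?\<sigma> = "restrict (Poly_Mapping.lookup m) P"
  let ?F = "\<lambda>\<sigma>. (\<Prod>a\<in>P. mps_X a ^ \<sigma> a) :: ('a, 'r) mps"
  have coeff: "mps_coeff (?F \<sigma>) m = (if \<sigma> = ?\<sigma> \<and> Poly_Mapping.keys m \<subseteq> P then 1 else 0)"
    if "\<sigma> \<in> P_partitions P r" for \<sigma>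
  proof -
    have "m = (\<Sum>a\<in>P. Poly_Mapping.single a (\<sigma> a)) \<longleftrightarrow>
        (\<forall>x. Poly_Mapping.lookup m x = (if x \<in> P then \<sigma> x else 0))"
      using assms(1) by (simp add: poly_mapping_eq_iff fun_eq_iff lookup_exponent_sum)
    also have "\<dots> \<longleftrightarrow> \<sigma> = ?\<sigma> \<and> (\<forall>x. x \<notin> P \<longrightarrow> Poly_Mapping.lookup m x = 0)"
    proof -
      have "\<sigma> \<in> extensional P"
        using that by (simp add: P_partitions_def PiE_def)
      then have restr: "\<sigma> = ?\<sigma> \<longleftrightarrow> (\<forall>x\<in>P. \<sigma> x = Poly_Mapping.lookup m x)"
        unfolding fun_eq_iff extensional_def restrict_def by simp metis
      show ?thesis
        unfolding restr by auto
    qed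
    also have "(\<forall>x. x \<notin> P \<longrightarrow> Poly_Mapping.lookup m x = 0) \<longleftrightarrow> Poly_Mapping.keys m \<subseteq> P"
      by (auto simp: in_keys_iff)
    finally have "m = (\<Sum>a\<in>P. Poly_Mapping.single a (\<sigma> a)) \<longleftrightarrow>
        \<sigma> = ?\<sigma> \<and> Poly_Mapping.keys m \<subseteq> P" .
    then show ?thesis
      using assms(1) by (simp add: mps_X_power_prod mps_monom_def)
  qed
  have mem: "?\<sigma> \<in> P_partitions P r \<and> Poly_Mapping.keys m \<subseteq> P \<longleftrightarrow> partition_exponent P r m"
  proof -
    have "(\<forall>(x, y) \<in> r. ?\<sigma> y \<le> ?\<sigma> x) \<longleftrightarrow>
        (\<forall>(x, y) \<in> r. Poly_Mapping.lookup m y \<le> Poly_Mapping.lookup m x)"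
    proof (rule ball_cong)
      fix p
      assume "p \<in> r"
      then have "fst p \<in> P" "snd p \<in> P"
        using assms(2) by auto
      then show "(case p of (x, y) \<Rightarrow> ?\<sigma> y \<le> ?\<sigma> x) \<longleftrightarrow>
          (case p of (x, y) \<Rightarrow> Poly_Mapping.lookup m y \<le> Poly_Mapping.lookup m x)"
        by (simp add: case_prod_unfold)
    qed simp
    moreover have "?\<sigma> \<in> P \<rightarrow>\<^sub>E UNIV"
      by (simp add: restrict_PiE_iff)
    ultimately show ?thesis
      unfolding P_partitions_def partition_exponent_def mem_Collect_eq by blast
  qed
  have "mps_coeff (P_partition_gf P r :: ('a, 'r) mps) m =
      (if ?\<sigma> \<in> P_partitions P r then mps_coeff (?F ?\<sigma>) m else 0)"
    unfolding P_partition_gf_def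
    by (rule mps_coeff_infsum_single [where F = ?F and j = ?\<sigma>]) (use coeff in simp)
  also have "\<dots> = (if partition_exponent P r m then 1 else 0)"
  proof (cases "?\<sigma> \<in> P_partitions P r")
    case True
    then show ?thesis
      using mem coeff [OF True] by argo
  next
    case False
    then show ?thesis
      using mem by argo
  qed
  finally show ?thesis .
qed

section \<open>Substituting a product of two variables\<close>

lemma subst_X_monomial:
  fixes m :: "'a \<Rightarrow>\<^sub>0 nat"
  shows "(\<Prod>i\<in>Poly_Mapping.keys m.
      (mps_X(c := mps_X b * mps_X c) :: 'a \<Rightarrow> ('a, 'r::comm_ring_1) mps) i ^ Poly_Mapping.lookup m i)
    = mps_monom (m + Poly_Mapping.single b (Poly_Mapping.lookup m c))"
proof -
  let ?l = "Poly_Mapping.lookup m"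
  let ?X = "mps_X :: 'a \<Rightarrow> ('a, 'r) mps"
  have "(\<Prod>i\<in>Poly_Mapping.keys m. (?X(c := mps_X b * mps_X c)) i ^ ?l i) =
      (\<Prod>i\<in>Poly_Mapping.keys m. (if i = c then ?X b ^ ?l c else 1) * ?X i ^ ?l i)"
    by (rule prod.cong) (auto simp: power_mult_distrib)
  \<comment> \<open>If \<open>c\<close> is not a key of \<open>m\<close>, its exponent is 0 and the
    extracted power of x_b is 1, so both cases agree.\<close>
  also have "\<dots> = ?X b ^ ?l c * (\<Prod>i\<in>Poly_Mapping.keys m. ?X i ^ ?l i)"
    by (simp add: prod.distrib in_keys_iff)
  also have "(\<Sum>i\<in>Poly_Mapping.keys m. Poly_Mapping.single i (?l i)) = m"
    by (rule poly_mapping_eqI) (simp add: lookup_exponent_sum in_keys_iff)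
  then have "(\<Prod>i\<in>Poly_Mapping.keys m. ?X i ^ ?l i) = mps_monom m"
    by (simp add: mps_X_power_prod)
  finally show ?thesis
    by (simp add: mps_X_power mps_monom_add mult.commute)
qed

text \<open>Since \<open>f\<close> does not involve x_b, every x_b in the result was produced by the
  substitution, one for each x_c. Erasing the exponent at \<open>b\<close> therefore recovers the
  only possible source monomial.\<close>

lemma mps_coeff_subst_X:
  fixes f :: "('a, 'r::comm_ring_1) mps"
  assumes "b \<noteq> c" and free: "\<And>m. Poly_Mapping.lookup m b \<noteq> 0 \<Longrightarrow> mps_coeff f m = 0"
  shows "mps_coeff (mps_subst (mps_X(c := mps_X b * mps_X c)) f) n =
    (if Poly_Mapping.lookup n b = Poly_Mapping.lookup n c
     then mps_coeff f (Poly_Mapping.update b 0 n) else 0)"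
proof -
  let ?l = Poly_Mapping.lookup
  let ?n = "Poly_Mapping.update b 0 n"
  let ?F = "\<lambda>m. mps_const (mps_coeff f m) *
    (\<Prod>i\<in>Poly_Mapping.keys m. (mps_X(c := mps_X b * mps_X c)) i ^ ?l m i)"
  have coeff: "mps_coeff (?F m) n =
      (if m = ?n \<and> ?l n b = ?l n c then mps_coeff f ?n else 0)" for m
  proof (cases "?l m b = 0")
    case True
    have "n = m + Poly_Mapping.single b (?l m c) \<longleftrightarrow> m = ?n \<and> ?l n b = ?l n c"
    proof
      assume n: "n = m + Poly_Mapping.single b (?l m c)"
      show "m = ?n \<and> ?l n b = ?l n c"
        using True assms(1) by (auto intro!: poly_mapping_eqI simp: n lookup_update lookup_add lookup_single when_def)
    next
      assume m: "m = ?n \<and> ?l n b = ?l n c"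
      then have "?l m = (?l n)(b := 0)"
        by (auto simp: lookup_update fun_eq_iff)
      then show "n = m + Poly_Mapping.single b (?l m c)"
        using assms(1) m
        by (intro poly_mapping_eqI) (auto simp: lookup_add lookup_single when_def)
    qed
    then show ?thesis
      unfolding subst_X_monomial mps_coeff_const_mult by (auto simp: mps_monom_def)
  next
    \<comment> \<open>Such an \<open>m\<close> differs from \<open>?n\<close>, whose exponent at
      \<open>b\<close> is 0, and its coefficient vanishes by \<open>free\<close>.\<close>
    case False
    then show ?thesis
      by (auto simp: mps_coeff_const_mult free lookup_update)
  qed
  have "mps_coeff (mps_subst (mps_X(c := mps_X b * mps_X c)) f) n = mps_coeff (?F ?n) n"
    unfolding mps_subst_def
    by (subst mps_coeff_infsum_single [where j = ?n]) (simp_all only: coeff UNIV_I simp_thms if_True if_False)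
  then show ?thesis
    by (simp only: coeff simp_thms)
qed

text \<open>The guard tests divisibility by x_b; without it, truncated subtraction would return
  \<open>m\<close> itself.\<close>

lemma mps_coeff_X_mult:
  "mps_coeff (mps_X b * f) m = (if Poly_Mapping.lookup m b = 0 then 0
    else mps_coeff f (m - Poly_Mapping.single b 1) :: 'r::comm_ring_1)"
proof -
  have "(\<exists>k. Poly_Mapping.single b 1 + k = m) \<longleftrightarrow> Poly_Mapping.lookup m b \<noteq> 0"
  proof
    assume "Poly_Mapping.lookup m b \<noteq> 0"
    then have "Poly_Mapping.single b 1 + (m - Poly_Mapping.single b 1) = m"
      by (intro poly_mapping_eqI) (auto simp: lookup_add lookup_minus lookup_single when_def)
    then show "\<exists>k. Poly_Mapping.single b 1 + k = m" ..
  qed (auto simp: lookup_add)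
  then show ?thesis
    by (simp add: mps_X_def mps_coeff_monom_mult)
qed

section \<open>Covers and deletion of one element\<close>

lemma covered_by_converse: "covered_by (r\<inverse>) x y \<longleftrightarrow> covered_by r y x"
  by (auto simp: covered_by_def)

text \<open>A minimal element of the half-open interval from \<open>x\<close> (excluded) to
  \<open>y\<close> (included) is a cover of \<open>x\<close>, because by transitivity anything
  strictly between would lie in that interval too.\<close>

lemma obtain_upper_cover:
  assumes "finite P" "partial_order_on P r" "(x, y) \<in> r" "x \<noteq> y"
  obtains z where "covered_by r x z" "(z, y) \<in> r"
proof -
  have tr: "trans r" and anti: "antisym r" and refl: "refl_on P r" and rP: "r \<subseteq> P \<times> P"
    using assms(2) by (auto simp: partial_order_on_def preorder_on_def)
  let ?A = "{z. (x, z) \<in> r - Id \<and> (z, y) \<in> r}"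
  let ?R = "\<lambda>u v. (u, v) \<in> r - Id"
  have "finite ?A"
    by (rule finite_subset [OF _ assms(1)]) (use rP in auto)
  moreover have "asymp_on ?A ?R" "transp_on ?A ?R"
    using tr anti by (auto intro!: asymp_onI transp_onI dest: antisymD transD)
  moreover have "y \<in> ?A"
    using assms(3,4) rP refl by (auto dest: refl_onD)
  ultimately obtain z where z: "z \<in> ?A" and min: "\<And>u. u \<in> ?A \<Longrightarrow> u \<noteq> z \<Longrightarrow> \<not> ?R u z"
    using Finite_Set.bex_min_element [of ?A ?R] by blast
  have "covered_by r x z"
    using z min tr by (auto simp: covered_by_def dest: transD)
  then show thesis
    using z that by blast
qed

lemma obtain_lower_cover:
  assumes "finite P" "partial_order_on P r" "(x, y) \<in> r" "x \<noteq> y"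
  obtains z where "covered_by r z y" "(x, z) \<in> r"
  using obtain_upper_cover [of P "r\<inverse>" y x] assms
  by (auto simp: covered_by_converse)

text \<open>A strict relation between \<open>b\<close> and another element factors through a cover
  of \<open>b\<close> on that side. The inequality then follows from the one at the cover and one
  between elements of \<open>P - {b}\<close>.\<close>

lemma partition_exponent_delete:
  fixes m :: "'a \<Rightarrow>\<^sub>0 nat"
  assumes P: "finite P" "partial_order_on P r" and bP: "b \<in> P"
  defines "m' \<equiv> Poly_Mapping.update b 0 m"
  shows "partition_exponent P r m \<longleftrightarrow>
    partition_exponent (P - {b}) (delete_order P r b) m' \<and>
    (\<forall>c. covered_by r b c \<longrightarrow> Poly_Mapping.lookup m c \<le> Poly_Mapping.lookup m b) \<and>
    (\<forall>a. covered_by r a b \<longrightarrow> Poly_Mapping.lookup m b \<le> Poly_Mapping.lookup m a)"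
    (is "_ \<longleftrightarrow> ?P' \<and> ?C \<and> ?A")
proof -
  let ?l = "Poly_Mapping.lookup m"
  have rP: "r \<subseteq> P \<times> P"
    using P(2) by (simp add: partial_order_on_def preorder_on_def)
  have l': "Poly_Mapping.lookup m' x = (if x = b then 0 else ?l x)" for x
    by (simp add: m'_def lookup_update)
  have keys: "Poly_Mapping.keys m' \<subseteq> P - {b} \<longleftrightarrow> Poly_Mapping.keys m \<subseteq> P"
    using bP by (auto simp: subset_iff in_keys_iff l')
  have "partition_exponent P r m" if "?P'" "?C" "?A"
  proof -
    have base: "?l y \<le> ?l x" if "(x, y) \<in> r" "x \<noteq> b" "y \<noteq> b" for x y
    proof -
      have "(x, y) \<in> delete_order P r b"
        using that rP by auto
      then have "Poly_Mapping.lookup m' y \<le> Poly_Mapping.lookup m' x"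
        using \<open>?P'\<close> by (auto simp only: partition_exponent_def)
      then show ?thesis
        using that by (simp add: l')
    qed
    have "?l y \<le> ?l x" if xy: "(x, y) \<in> r" for x y
    proof (cases "x = y \<or> (x \<noteq> b \<and> y \<noteq> b)")
      case True
      then show ?thesis
        using base xy by auto
    next
      case False
      then consider "x = b" "y \<noteq> b" | "y = b" "x \<noteq> b"
        by auto
      then show ?thesis
      proof cases
        case 1
        then obtain c where c: "covered_by r b c" "(c, y) \<in> r"
          using obtain_upper_cover [OF P xy] by auto
        then have "?l y \<le> ?l c"
          using base 1 by (auto simp: covered_by_def)
        also have "\<dots> \<le> ?l b"
          using \<open>?C\<close> c by blast
        finally show ?thesis
          using 1 by simp
      next
        case 2
        then obtain a where a: "covered_by r a b" "(x, a) \<in> r"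
          using obtain_lower_cover [OF P xy] by auto
        have "?l b \<le> ?l a"
          using \<open>?A\<close> a by blast
        also have "\<dots> \<le> ?l x"
          using base 2 a by (auto simp: covered_by_def)
        finally show ?thesis
          using 2 by simp
      qed
    qed
    then show ?thesis
      using \<open>?P'\<close> keys by (auto simp: partition_exponent_def)
  qed
  moreover have "?P' \<and> ?C \<and> ?A" if "partition_exponent P r m"
    using that keys by (auto simp: partition_exponent_def l' covered_by_def)
  ultimately show ?thesis
    by blast
qed

section \<open>Comparison of coefficients at a removable element\<close>

theorem theorem2p1:
  fixes P :: "'a set" and r :: "'a rel" and b :: 'a
  assumes "finite P" and "partial_order_on P r" and "removable P r b"
  shows "(P_partition_gf P r :: ('a, 'r::comm_ring_1) mps) =
    (removal_g P r b - removal_h P r b) / (1 - mps_X b)"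
  unfolding mps_eq_divide_one_minus_X_iff
proof (rule mps_eqI)
  fix n :: "'a \<Rightarrow>\<^sub>0 nat"
  let ?l = "Poly_Mapping.lookup n"
  let ?n' = "Poly_Mapping.update b 0 n"
  let ?n1 = "n - Poly_Mapping.single b 1"
  let ?Q = "partition_exponent (P - {b}) (delete_order P r b)"
  let ?f' = "P_partition_gf (P - {b}) (delete_order P r b) :: ('a, 'r) mps"
  have rP: "r \<subseteq> P \<times> P"
    using assms(2) by (simp add: partial_order_on_def preorder_on_def)
  have bP: "b \<in> P"
    using assms(3) by (simp add: removable_def)
  have uniq: "\<exists>\<^sub>\<le>\<^sub>1 a. a \<in> P \<and> covered_by r a b" "\<exists>\<^sub>\<le>\<^sub>1 c. c \<in> P \<and> covered_by r b c"
    using assms(3) by (auto simp: removable_def)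
  have cov: "x \<in> P" "y \<in> P" "x \<noteq> y" "(x, y) \<in> r" if "covered_by r x y" for x y
    using that rP by (auto simp: covered_by_def)
  have f': "mps_coeff ?f' m = (if ?Q m then 1 else 0)" for m
    by (rule mps_coeff_P_partition_gf) (use assms(1) in auto)
  have free: "mps_coeff ?f' m = 0" if "Poly_Mapping.lookup m b \<noteq> 0" for m
    using that by (auto simp: f' partition_exponent_def in_keys_iff subset_iff)
  have subst: "mps_coeff (mps_subst (mps_X(c := mps_X b * mps_X c)) ?f') m =
      (if Poly_Mapping.lookup m b = Poly_Mapping.lookup m c \<and> ?Q (Poly_Mapping.update b 0 m)
       then 1 else 0)" if "b \<noteq> c" for c m
    using mps_coeff_subst_X [OF that free] by (simp only: f' split: if_split) simp
  have n1: "Poly_Mapping.lookup ?n1 x = (if x = b then ?l b - 1 else ?l x)" for x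
    by (simp add: lookup_minus lookup_single when_def)
  \<comment> \<open>Dividing by x_b changes only the exponent at \<open>b\<close>, so
    \<open>n\<close> and \<open>?n1\<close> have the same underlying exponents on
    \<open>P - {b}\<close>.\<close>
  have n1': "Poly_Mapping.update b 0 ?n1 = ?n'"
    by (rule poly_mapping_eqI) (auto simp: lookup_update n1 [simplified])
  have zero: "?n' = n" if "?l b = 0"
    using that by (intro poly_mapping_eqI) (auto simp: lookup_update)
  \<comment> \<open>The condition says that \<open>?l b\<close> is the least value admissible at
    \<open>b\<close>.\<close>
  have g: "mps_coeff (removal_g P r b :: ('a, 'r) mps) n = (if ?Q ?n' \<and> ?l b = ?l c then 1 else 0)"
    if c: "covered_by r b c" for c
  proof -
    have "(THE c. c \<in> P \<and> covered_by r b c) = c"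
      using c cov by (intro the1_equality' [OF uniq(2)]) auto
    then have "removal_g P r b = mps_subst (mps_X(c := mps_X b * mps_X c)) ?f'"
      using c cov unfolding removal_g_def Let_def by auto
    then show ?thesis
      using cov(3) [OF c] by (auto simp: subst)
  qed
  \<comment> \<open>Without an upper cover the least admissible value is 0.\<close>
  have g0: "mps_coeff (removal_g P r b :: ('a, 'r) mps) n = (if ?Q ?n' \<and> ?l b = 0 then 1 else 0)"
    if "\<nexists>c. covered_by r b c"
  proof -
    have "removal_g P r b = ?f'"
      using that unfolding removal_g_def Let_def by auto
    then show ?thesis
      using free [of n] f' [of n] zero by (cases "?l b = 0") simp_all
  qed
  \<comment> \<open>The substitution alone forces exponent \<open>?l a\<close> at \<open>b\<close>,
    the largest admissible value; the extra factor x_b moves it one past the end.\<close>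
  have h: "mps_coeff (removal_h P r b :: ('a, 'r) mps) n = (if ?Q ?n' \<and> ?l b = Suc (?l a) then 1 else 0)"
    if a: "covered_by r a b" for a
  proof -
    have "(THE a. a \<in> P \<and> covered_by r a b) = a"
      using a cov by (intro the1_equality' [OF uniq(1)]) auto
    then have eq: "removal_h P r b = mps_X b * mps_subst (mps_X(a := mps_X b * mps_X a)) ?f'"
      using a cov unfolding removal_h_def Let_def by (auto simp: mult.commute)
    have "mps_coeff (removal_h P r b :: ('a, 'r) mps) n =
        (if ?l b \<noteq> 0 \<and> ?l b - 1 = ?l a \<and> ?Q ?n' then 1 else 0)"
      unfolding eq mps_coeff_X_mult subst [OF cov(3) [OF a, symmetric]] n1 n1'
      using cov(3) [OF a] by simp
    moreover have "?l b \<noteq> 0 \<and> ?l b - 1 = ?l a \<longleftrightarrow> ?l b = Suc (?l a)"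
      by auto
    ultimately show ?thesis
      by auto
  qed
  have h0: "mps_coeff (removal_h P r b :: ('a, 'r) mps) n = 0" if "\<nexists>a. covered_by r a b"
    using that unfolding removal_h_def Let_def by auto
  \<comment> \<open>Uniqueness lets each quantifier over covers collapse to a single
    inequality.\<close>
  have only: "covered_by r b c \<Longrightarrow> covered_by r b c' \<Longrightarrow> c' = c"
    "covered_by r a b \<Longrightarrow> covered_by r a' b \<Longrightarrow> a' = a" for a a' c c'
    using Uniq_D [OF uniq(1), of a' a] Uniq_D [OF uniq(2), of c' c] cov(1,2) by simp_all
  \<comment> \<open>The interval of admissible values is nonempty, so the two boundary terms are
    really its ends.\<close>
  have le: "?l c \<le> ?l a" if "covered_by r a b" "covered_by r b c" "?Q ?n'" for a c
  proof -
    have "trans r"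
      using assms(2) by (simp add: partial_order_on_def preorder_on_def)
    then have "(a, c) \<in> r"
      using cov(4) [OF that(1)] cov(4) [OF that(2)] by (rule transD)
    then have "(a, c) \<in> delete_order P r b"
      using cov [OF that(1)] cov [OF that(2)] by simp
    then have "Poly_Mapping.lookup ?n' c \<le> Poly_Mapping.lookup ?n' a"
      using that(3) by (auto simp only: partition_exponent_def)
    then show ?thesis
      using cov(3) [OF that(1)] cov(3) [OF that(2)] by (simp add: lookup_update)
  qed
  have rem: "partition_exponent P r m \<longleftrightarrow> ?Q (Poly_Mapping.update b 0 m) \<and>
    (\<forall>c. covered_by r b c \<longrightarrow> Poly_Mapping.lookup m c \<le> Poly_Mapping.lookup m b) \<and>
    (\<forall>a. covered_by r a b \<longrightarrow> Poly_Mapping.lookup m b \<le> Poly_Mapping.lookup m a)" for m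
    by (rule partition_exponent_delete [OF assms(1,2) bP])
  have "mps_coeff ((1 - mps_X b) * P_partition_gf P r :: ('a, 'r) mps) n =
      (if partition_exponent P r n then 1 else 0) -
      (if ?l b \<noteq> 0 \<and> partition_exponent P r ?n1 then 1 else 0)"
    using assms(1) rP
    by (simp only: left_diff_distrib mps_coeff_diff mps_coeff_X_mult mult_1_left mps_coeff_P_partition_gf) simp
  \<comment> \<open>Covers of \<open>b\<close> differ from \<open>b\<close>, so passing to
    \<open>?n1\<close> shifts only the value compared with the bounds.\<close>
  moreover have "partition_exponent P r ?n1 \<longleftrightarrow> ?Q ?n' \<and>
      (\<forall>c. covered_by r b c \<longrightarrow> ?l c \<le> ?l b - 1) \<and>
      (\<forall>a. covered_by r a b \<longrightarrow> ?l b - 1 \<le> ?l a)"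
    unfolding rem [of ?n1] n1 n1'
    by (intro conj_cong refl iff_allI imp_cong) (auto dest: cov(3))
  ultimately have lhs: "mps_coeff ((1 - mps_X b) * P_partition_gf P r :: ('a, 'r) mps) n =
      (if ?Q ?n' \<and> (\<forall>c. covered_by r b c \<longrightarrow> ?l c \<le> ?l b) \<and>
         (\<forall>a. covered_by r a b \<longrightarrow> ?l b \<le> ?l a) then 1 else 0) -
      (if ?l b \<noteq> 0 \<and> ?Q ?n' \<and> (\<forall>c. covered_by r b c \<longrightarrow> ?l c \<le> ?l b - 1) \<and>
         (\<forall>a. covered_by r a b \<longrightarrow> ?l b - 1 \<le> ?l a) then 1 else 0)"
    by (simp only: rem [of n])
  \<comment> \<open>When \<open>?Q ?n'\<close> holds, the left side is 1 if \<open>?l b\<close> is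
    the lower end of the interval, -1 if it is one past the upper end, and 0 otherwise. A missing
    lower cover means no upper end, hence no negative term.\<close>
  show "mps_coeff ((1 - mps_X b) * P_partition_gf P r) n =
    mps_coeff (removal_g P r b - removal_h P r b :: ('a, 'r) mps) n"
  proof (cases "\<exists>c. covered_by r b c")
    case True
    then obtain c where c: "covered_by r b c" ..
    then have C: "covered_by r b c' \<longleftrightarrow> c' = c" for c'
      using only by blast
    show ?thesis
    proof (cases "\<exists>a. covered_by r a b")
      case True
      then obtain a where a: "covered_by r a b" ..
      then have A: "covered_by r a' b \<longleftrightarrow> a' = a" for a'
        using only by blast
      show ?thesis
        unfolding lhs mps_coeff_diff g [OF c] h [OF a] A C
        using le [OF a c] by auto
    next
      case False
      then show ?thesis
        unfolding lhs mps_coeff_diff g [OF c] h0 [OF False] C by auto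
    qed
  next
    case noC: False
    show ?thesis
    proof (cases "\<exists>a. covered_by r a b")
      case True
      then obtain a where a: "covered_by r a b" ..
      then have A: "covered_by r a' b \<longleftrightarrow> a' = a" for a'
        using only by blast
      show ?thesis
        unfolding lhs mps_coeff_diff g0 [OF noC] h [OF a] A using noC by auto
    next
      case False
      then show ?thesis
        unfolding lhs mps_coeff_diff g0 [OF noC] h0 [OF False] using noC by auto
    qed
  qed
qed

end
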